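(* Let $(a_n;n\geq 1)$ be a sequence of complex numbers with $a_j\neq 0$ for all $j\geq 1$, and let $\varphi,g,h$ be power series with $\varphi(0)=0$ and $\varphi'(0)g(0)h(0)\neq 0$. Let $\mathcal{A}$ be the upper triangular matrix, indexed by $k,n\geq 1$, with entries \[ [\mathcal{A}]_{k,n}=\frac{a_k}{a_n}\frac{1}{k!}\left(\frac{d}{dt}\right)^{n-1}_{t=0}\left[(h(t))^n\frac{d}{dt}\left((\varphi(t))^k g(t)\right)\right]\quad (k\leq n), \] and $[\mathcal{A}]_{k,n}=0$ for $k>n$. Let $\psi=\varphi^{\langle -1\rangle}$ and let $\omega$ be the power series with $\omega(0)=0$ satisfying $\omega(t)=t\,h(\omega(t))$. Then $\frac{\psi}{h\circ\psi}=(\varphi\circ\omega)^{\langle -1\rangle}$, and for every non-negative integer $s$, \[ [\mathcal{A}^{-s}]_{k,n}=\frac{a_k}{a_n}\frac{1}{k!}\left(\frac{d}{dt}\right)^{n}_{t=0}\left[\left(\left(\frac{\psi}{h\circ\psi}\right)^{\langle s\rangle}(t)\right)^k\left(\prod_{i=0}^{s-1} g\circ\psi\circ\left(\frac{\psi}{h\circ\psi}\right)^{\langle i\rangle}(t)\right)^{-1}\right]. \]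
   Context: All power series are formal power series with complex coefficients. $\left(\frac{d}{dt}\right)^{m}_{t=0}F$ denotes the $m$-th derivative of $F$ at $t=0$. $\varphi^{\langle -1\rangle}$ is the compositional inverse of $\varphi$; $\frac{\psi}{h\circ\psi}$ denotes the power series $t\mapsto \psi(t)/h(\psi(t))$. For a power series $\phi$ with $\phi(0)=0$: $\phi^{\langle 0\rangle}(t)=t$, $\phi^{\langle s\rangle}=\phi^{\langle s-1\rangle}\circ\phi$ for $s\geq 1$. $\mathcal{A}^{-s}:=(\mathcal{A}^{-1})^s$, with $\mathcal{A}^0$ the identity; the empty product equals $1$. *)

theory Defs
  imports
    Complex_Main
    "HOL-Computational_Algebra.Formal_Power_Series"
    "HOL-Algebra.Group"
begin

text \<open>
  Infinite matrices with index set \<open>{1, 2, ...}\<close> are functions on \<^typ>\<open>nat\<close> whose entries with a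
  zero index are irrelevant; they are set to \<open>0\<close> so that equality of matrices is equality of
  functions. For upper triangular \<open>B\<close> the formal sum of \<open>A k j * B j n\<close> over all \<open>j \<ge> 1\<close>
  has no terms beyond \<open>j = n\<close>, whence the range in the product.
\<close>

definition upper_triangular_mats :: "(nat \<Rightarrow> nat \<Rightarrow> complex) set" where
  "upper_triangular_mats = {A. \<forall>k n. \<not> (1 \<le> k \<and> k \<le> n) \<longrightarrow> A k n = 0}"

definition UT :: "(nat \<Rightarrow> nat \<Rightarrow> complex) monoid" where
  "UT = \<lparr>carrier = upper_triangular_mats,
         mult = (\<lambda>A B k n. \<Sum>j=1..n. A k j * B j n),
         one = (\<lambda>k n. if 1 \<le> k \<and> k = n then 1 else 0)\<rparr>"

lemma UT_monoid: "monoid UT"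
proof (rule monoidI)
  fix A B assume "A \<in> carrier UT" "B \<in> carrier UT"
  then show "A \<otimes>\<^bsub>UT\<^esub> B \<in> carrier UT"
    unfolding UT_def upper_triangular_mats_def
    by (clarsimp, intro sum.neutral ballI) (metis atLeastAtMost_iff le_trans mult_zero_left mult_zero_right)
next
  show "\<one>\<^bsub>UT\<^esub> \<in> carrier UT"
    by (auto simp: UT_def upper_triangular_mats_def)
next
  fix A B C
  assume "A \<in> carrier UT" and B: "B \<in> carrier UT" and "C \<in> carrier UT"
  show "A \<otimes>\<^bsub>UT\<^esub> B \<otimes>\<^bsub>UT\<^esub> C = A \<otimes>\<^bsub>UT\<^esub> (B \<otimes>\<^bsub>UT\<^esub> C)"
  proof (intro ext)
    fix k n
    have "(\<Sum>j=1..n. (\<Sum>i=1..j. A k i * B i j) * C j n)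
        = (\<Sum>j=1..n. \<Sum>i=1..n. A k i * B i j * C j n)"
    proof (rule sum.cong[OF refl])
      fix j assume "j \<in> {1..n}"
      then have "(\<Sum>i=1..j. A k i * B i j) = (\<Sum>i=1..n. A k i * B i j)"
        using B by (intro sum.mono_neutral_left) (auto simp: UT_def upper_triangular_mats_def)
      then show "(\<Sum>i=1..j. A k i * B i j) * C j n = (\<Sum>i=1..n. A k i * B i j * C j n)"
        by (simp add: sum_distrib_right)
    qed
    also have "\<dots> = (\<Sum>i=1..n. \<Sum>j=1..n. A k i * B i j * C j n)"
      by (rule sum.swap)
    finally show "(A \<otimes>\<^bsub>UT\<^esub> B \<otimes>\<^bsub>UT\<^esub> C) k n = (A \<otimes>\<^bsub>UT\<^esub> (B \<otimes>\<^bsub>UT\<^esub> C)) k n"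
      by (simp add: UT_def sum_distrib_left mult.assoc)
  qed
next
  fix A assume A: "A \<in> carrier UT"
  show "\<one>\<^bsub>UT\<^esub> \<otimes>\<^bsub>UT\<^esub> A = A"
  proof (intro ext)
    fix k n
    have "(\<Sum>j=1..n. (if 1 \<le> k \<and> k = j then 1 else 0) * A j n)
        = (\<Sum>j=1..n. if k = j then A j n else 0)"
      by (intro sum.cong) auto
    also have "\<dots> = A k n"
      using A by (auto simp: UT_def upper_triangular_mats_def)
    finally show "(\<one>\<^bsub>UT\<^esub> \<otimes>\<^bsub>UT\<^esub> A) k n = A k n"
      by (simp add: UT_def)
  qed
  show "A \<otimes>\<^bsub>UT\<^esub> \<one>\<^bsub>UT\<^esub> = A"
  proof (intro ext)
    fix k n
    have "(\<Sum>j=1..n. A k j * (if 1 \<le> j \<and> j = n then 1 else 0))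
        = (\<Sum>j=1..n. if j = n then A k j else 0)"
      by (intro sum.cong) auto
    also have "\<dots> = A k n"
      using A by (auto simp: UT_def upper_triangular_mats_def)
    finally show "(A \<otimes>\<^bsub>UT\<^esub> \<one>\<^bsub>UT\<^esub>) k n = A k n"
      by (simp add: UT_def)
  qed
qed

definition matA ::
  "(nat \<Rightarrow> complex) \<Rightarrow> complex fps \<Rightarrow> complex fps \<Rightarrow> complex fps \<Rightarrow> nat \<Rightarrow> nat \<Rightarrow> complex" where
  "matA a \<phi> g h k n =
     (if 1 \<le> k \<and> k \<le> n
      then a k / a n * (1 / fact k) *
           fps_nth (fps_nth_deriv (n - 1) (h ^ n * fps_deriv (\<phi> ^ k * g))) 0
      else 0)"

primrec fps_iter :: "complex fps \<Rightarrow> nat \<Rightarrow> complex fps" where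
  "fps_iter \<phi> 0 = fps_X"
| "fps_iter \<phi> (Suc s) = fps_iter \<phi> s oo \<phi>"

text \<open>The functional equation \<open>\<omega>(t) = t h(\<omega>(t))\<close> determines \<open>\<omega>\<close>.\<close>

lemma ex1_omega:
  fixes h :: "complex fps"
  assumes h0: "fps_nth h 0 \<noteq> 0"
  shows "\<exists>!\<omega>. fps_nth \<omega> 0 = 0 \<and> \<omega> = fps_X * (h oo \<omega>)"
proof -
  define r where "r = fps_X * inverse h"
  have r0: "fps_nth r 0 = 0" and r1: "fps_nth r 1 \<noteq> 0"
    using h0 by (simp_all add: r_def)
  have iff: "\<omega> = fps_X * (h oo \<omega>) \<longleftrightarrow> r oo \<omega> = fps_X" if w0: "fps_nth \<omega> 0 = 0" for \<omega>
  proof -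
    have hw: "fps_nth (h oo \<omega>) 0 \<noteq> 0"
      using h0 by simp
    have "r oo \<omega> = \<omega> * inverse (h oo \<omega>)"
      using w0 h0 by (simp add: r_def fps_compose_mult_distrib fps_inverse_compose)
    then show ?thesis
      using inverse_mult_eq_1[OF hw] by (smt (verit) mult.assoc mult.commute mult.right_neutral)
  qed
  show ?thesis
  proof (rule ex1I[of _ "fps_inv r"])
    have i0: "fps_nth (fps_inv r) 0 = 0"
      by (simp add: fps_inv_def)
    then show "fps_nth (fps_inv r) 0 = 0 \<and> fps_inv r = fps_X * (h oo fps_inv r)"
      using iff[OF i0] fps_inv_right[OF r0 r1] by simp
  next
    fix \<omega> assume w: "fps_nth \<omega> 0 = 0 \<and> \<omega> = fps_X * (h oo \<omega>)"
    then have w0: "fps_nth \<omega> 0 = 0" and rw: "r oo \<omega> = fps_X"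
      using iff by auto
    have "\<omega> = (fps_inv r oo r) oo \<omega>"
      using fps_inv[OF r0 r1] w0 by simp
    also have "\<dots> = fps_inv r oo (r oo \<omega>)"
      using fps_compose_assoc[OF w0 r0] by simp
    finally show "\<omega> = fps_inv r"
      using rw by simp
  qed
qed

end

theory Submission
  imports Defs
begin

text \<open>
  By Lagrange inversion, \<open>\<A>\<close> is the generalized Riordan matrix whose \<open>(k, n)\<close> entry is
  \<open>a\<^sub>k n! / (a\<^sub>n k!)\<close> times the coefficient of \<open>t\<^sup>n\<close> in \<open>(g \<circ> \<omega>) (\<phi> \<circ> \<omega>)\<^sup>k\<close>. Generalized Riordan
  matrices multiply by composing their second parameters, so \<open>\<A>\<^sup>-\<^sup>1\<close> is the one attached to
  the compositional inverse of \<open>\<phi> \<circ> \<omega>\<close>, and its powers follow by induction.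
\<close>

section \<open>Composition of power series and Lagrange inversion\<close>

text \<open>Since \<open>b\<close> has no constant term, \<open>b ^ j\<close> starts at degree at
  least \<open>j\<close>, so in degree \<open>n\<close> the series of \<open>f oo b\<close> may be
  cut off at any \<open>m\<close> from \<open>n\<close> on. A common bound for all summands of the
  Cauchy product permits swapping the sums.\<close>

lemma fps_nth_mult_compose:
  fixes b c f :: "'a::idom fps"
  assumes b0: "fps_nth b 0 = 0" and nm: "n \<le> m"
  shows "fps_nth (c * (f oo b)) n = (\<Sum>j=0..m. fps_nth f j * fps_nth (c * b ^ j) n)"
proof -
  have "fps_nth (f oo b) (n - i) = (\<Sum>j=0..m. fps_nth f j * fps_nth (b ^ j) (n - i))" for i
    unfolding fps_compose_nth using nm startsby_zero_power_prefix[OF b0]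
    by (intro sum.mono_neutral_left) auto
  then have "fps_nth (c * (f oo b)) n =
      (\<Sum>i=0..n. \<Sum>j=0..m. fps_nth f j * (fps_nth c i * fps_nth (b ^ j) (n - i)))"
    by (simp add: fps_mult_nth sum_distrib_left mult_ac)
  also have "\<dots> = (\<Sum>j=0..m. \<Sum>i=0..n. fps_nth f j * (fps_nth c i * fps_nth (b ^ j) (n - i)))"
    by (rule sum.swap)
  finally show ?thesis
    by (simp add: fps_mult_nth sum_distrib_left)
qed

lemma fps_inv_unique:
  fixes f w :: "'a::field fps"
  assumes f0: "fps_nth f 0 = 0" and f1: "fps_nth f 1 \<noteq> 0"
    and w0: "fps_nth w 0 = 0" and fw: "f oo w = fps_X"
  shows "w = fps_inv f"
proof -
  have "w = (fps_inv f oo f) oo w"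
    using fps_inv[OF f0 f1] w0 by simp
  also have "\<dots> = fps_inv f oo (f oo w)"
    using fps_compose_assoc[OF w0 f0] by simp
  finally show ?thesis
    using fw by simp
qed

lemma fps_inv_nth_0 [simp]: "fps_nth (fps_inv f) 0 = 0"
  by (simp add: fps_inv_def)

lemma fps_compose_nth_1: "fps_nth w 0 = 0 \<Longrightarrow> fps_nth (f oo w) 1 = fps_nth f 1 * fps_nth w 1"
  for f w :: "'a::idom fps"
  by (simp add: fps_compose_nth)

text \<open>With \<open>r = t / h\<close>, this says that the residue of \<open>r\<^sup>j\<^sup>-\<^sup>n r'\<close> is \<open>1\<close> if \<open>n = j + 1\<close> and \<open>0\<close>
  otherwise, because \<open>h\<^sup>n = t\<^sup>n r\<^sup>-\<^sup>n\<close>.\<close>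

lemma residue_power_deriv:
  fixes h r :: "'a::field_char_0 fps"
  assumes hr: "h * r = fps_X" and r0: "fps_nth r 0 = 0" and n: "1 \<le> n"
  shows "fps_nth (h ^ n * fps_deriv r * r ^ j) (n - 1) = (if n = Suc j then 1 else 0)"
proof (cases "n \<le> j")
  case True
  then have "r ^ j = r ^ n * r ^ (j - n)"
    by (simp flip: power_add)
  \<comment> \<open>The factor \<open>(h * r) ^ n\<close> is \<open>fps_X ^ n\<close>, which leaves
    nothing in degree \<open>n - 1\<close>.\<close>
  then have "h ^ n * fps_deriv r * r ^ j = (h * r) ^ n * (fps_deriv r * r ^ (j - n))"
    by (simp add: power_mult_distrib mult_ac)
  then show ?thesis
    unfolding hr using True n by (simp only: fps_X_power_mult_nth) simp
next
  case False
  then obtain m where m: "n = Suc (j + m)"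
    by (metis less_iff_Suc_add not_le)
  have d: "fps_deriv h * r + h * fps_deriv r = 1"
    using arg_cong[OF hr, of fps_deriv] by (simp add: add.commute)
  \<comment> \<open>Splitting off \<open>(h * r) ^ j = fps_X ^ j\<close> lowers the degree in
    question from \<open>n - 1\<close> to \<open>m\<close>.\<close>
  have "h ^ n * fps_deriv r * r ^ j = (h * r) ^ j * (h ^ m * (h * fps_deriv r))"
    by (simp add: m power_add power_mult_distrib mult_ac)
  also have "h * fps_deriv r = 1 - fps_deriv h * r"
    using d by (simp add: algebra_simps)
  also have "h ^ m * (1 - fps_deriv h * r) = h ^ m - h ^ m * fps_deriv h * r"
    by (simp add: algebra_simps)
  finally have eq: "fps_nth (h ^ n * fps_deriv r * r ^ j) (n - 1) =
      fps_nth (h ^ m) m - fps_nth (h ^ m * fps_deriv h * r) m"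
    unfolding hr by (simp only: fps_X_power_mult_nth) (simp add: m)
  show ?thesis
  proof (cases m)
    case 0
    then show ?thesis
      using eq m r0 by simp
  next
    case (Suc l)
    \<comment> \<open>The two coefficients in \<open>eq\<close> cancel for \<open>m > 0\<close>:
      multiplied by \<open>m\<close>, the second one comes from
      \<open>fps_X * fps_deriv (h ^ m)\<close>, and \<open>m\<close> is cancelled by characteristic
      zero.\<close>
    have "of_nat m * fps_nth (h ^ m * fps_deriv h * r) m =
        fps_nth (of_nat m * (h ^ m * fps_deriv h * r)) m"
      by (simp add: fps_of_nat[symmetric])
    also have "of_nat m * (h ^ m * fps_deriv h * r) = (h * r) * fps_deriv (h ^ m)"
      unfolding fps_deriv_power' by (simp add: Suc mult_ac)
    also have "fps_nth \<dots> m = of_nat m * fps_nth (h ^ m) m"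
      by (simp add: hr Suc del: power_Suc fps_deriv_mult)
    finally have "fps_nth (h ^ m * fps_deriv h * r) m = fps_nth (h ^ m) m"
      using Suc by (simp only: mult_cancel_left of_nat_eq_0_iff) simp
    then show ?thesis
      unfolding eq using m Suc by simp
  qed
qed

text \<open>The series \<open>w\<close> is inverse to \<open>r = t / h\<close>, so
  \<open>F = (F oo w) oo r\<close>. Expanding \<open>fps_deriv F\<close> in terms
  \<open>r ^ j * fps_deriv r\<close> and applying \<open>residue_power_deriv\<close> leaves only
  \<open>j = n - 1\<close>.\<close>

lemma lagrange_inversion:
  fixes F h w :: "'a::field_char_0 fps"
  assumes h0: "fps_nth h 0 \<noteq> 0" and w0: "fps_nth w 0 = 0" and w: "w = fps_X * (h oo w)"
    and n: "1 \<le> n"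
  shows "fps_nth (h ^ n * fps_deriv F) (n - 1) = of_nat n * fps_nth (F oo w) n"
proof -
  define r where "r = fps_X * inverse h"
  have r0: "fps_nth r 0 = 0" and r1: "fps_nth r 1 \<noteq> 0"
    using h0 by (simp_all add: r_def)
  have hr: "h * r = fps_X"
    using inverse_mult_eq_1'[OF h0] by (simp add: r_def mult_ac)
  have "r oo w = w * inverse (h oo w)"
    using w0 h0 by (simp add: r_def fps_compose_mult_distrib fps_inverse_compose)
  also have "\<dots> = fps_X * ((h oo w) * inverse (h oo w))"
    by (subst (1) w) (simp add: mult_ac)
  also have "\<dots> = fps_X"
    using h0 by (simp add: inverse_mult_eq_1')
  finally have "w = fps_inv r"
    using fps_inv_unique r0 r1 w0 by blast
  then have wr: "w oo r = fps_X"
    using fps_inv r0 r1 by blast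
  have "F = (F oo w) oo r"
    using fps_compose_assoc[OF r0 w0, of F] wr by simp
  then have "fps_deriv F = (fps_deriv (F oo w) oo r) * fps_deriv r"
    using fps_compose_deriv[OF r0] by metis
  then have "fps_nth (h ^ n * fps_deriv F) (n - 1) =
      fps_nth ((h ^ n * fps_deriv r) * (fps_deriv (F oo w) oo r)) (n - 1)"
    by (simp add: mult_ac)
  also have "\<dots> = (\<Sum>j=0..n - 1. fps_nth (fps_deriv (F oo w)) j * (if n = Suc j then 1 else 0))"
    by (simp only: fps_nth_mult_compose[OF r0 order_refl] residue_power_deriv[OF hr r0 n])
  also have "\<dots> = (\<Sum>j=0..n - 1. if j = n - 1 then of_nat n * fps_nth (F oo w) n else 0)"
    using n by (intro sum.cong) auto
  finally show ?thesis
    by simp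
qed

section \<open>Products, inverses and powers of generalized Riordan matrices\<close>

text \<open>For \<open>f\<close> without constant term and nonzero \<open>a j\<close>, this is the
  transposed exponential Riordan array of \<open>(d, f)\<close>, restricted to positive indices and
  conjugated by the diagonal matrix of the \<open>a j\<close>.\<close>

definition riordan :: "(nat \<Rightarrow> complex) \<Rightarrow> complex fps \<Rightarrow> complex fps \<Rightarrow> nat \<Rightarrow> nat \<Rightarrow> complex" where
  "riordan a d f k n =
     (if 1 \<le> k \<and> k \<le> n then a k / a n * (fact n / fact k) * fps_nth (d * f ^ k) n else 0)"

lemma fps_nth_mult_power_less:
  fixes d f :: "'a::idom fps"
  assumes "fps_nth f 0 = 0" and "n < k"
  shows "fps_nth (d * f ^ k) n = 0"
  using startsby_zero_power_prefix[OF assms(1), of k] assms(2) by (simp add: fps_mult_nth)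

lemma riordan_nth:
  assumes "fps_nth f 0 = 0" and "1 \<le> k"
  shows "riordan a d f k n = a k / a n * (fact n / fact k) * fps_nth (d * f ^ k) n"
  using fps_nth_mult_power_less[OF assms(1)] assms(2) by (auto simp: riordan_def not_le)

lemma riordan_in_carrier: "riordan a d f \<in> carrier UT"
  by (simp add: UT_def upper_triangular_mats_def riordan_def)

text \<open>The factors \<open>a j\<close> and \<open>fact j\<close> cancel in the sum over
  \<open>j\<close>; what remains expands \<open>(d * f ^ k) oo f'\<close> in powers of
  \<open>f'\<close>.\<close>

lemma riordan_mult:
  assumes a: "\<And>j. j \<ge> 1 \<Longrightarrow> a j \<noteq> 0"
    and f0: "fps_nth f 0 = 0" and f'0: "fps_nth f' 0 = 0"
  shows "riordan a d f \<otimes>\<^bsub>UT\<^esub> riordan a d' f' = riordan a (d' * (d oo f')) (f oo f')"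
proof (intro ext)
  fix k n
  show "(riordan a d f \<otimes>\<^bsub>UT\<^esub> riordan a d' f') k n = riordan a (d' * (d oo f')) (f oo f') k n"
  proof (cases "1 \<le> k")
    case False
    then show ?thesis
      by (simp add: UT_def riordan_def)
  next
    case True
    have term_eq: "riordan a d f k j * riordan a d' f' j n =
        a k / a n * (fact n / fact k) * (fps_nth (d * f ^ k) j * fps_nth (d' * f' ^ j) n)"
      if "1 \<le> j" for j
      using a[OF that] by (simp only: riordan_nth[OF f0 True] riordan_nth[OF f'0 that]) (simp add: mult_ac)
    have "(d' * (d oo f')) * (f oo f') ^ k = d' * ((d * f ^ k) oo f')"
      by (simp add: fps_compose_power[OF f'0] fps_compose_mult_distrib[OF f'0] mult_ac)
    then have "fps_nth (d' * (d oo f') * (f oo f') ^ k) n =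
        (\<Sum>j=0..n. fps_nth (d * f ^ k) j * fps_nth (d' * f' ^ j) n)"
      by (simp only: fps_nth_mult_compose[OF f'0 order_refl])
    \<comment> \<open>The term \<open>j = 0\<close> vanishes because \<open>k\<close> is positive
      and \<open>f\<close> has no constant term.\<close>
    also have "\<dots> = (\<Sum>j=1..n. fps_nth (d * f ^ k) j * fps_nth (d' * f' ^ j) n)"
      using True f0 by (simp add: sum.atLeast_Suc_atMost)
    finally have "riordan a (d' * (d oo f')) (f oo f') k n =
        (\<Sum>j=1..n. riordan a d f k j * riordan a d' f' j n)"
      using f0 True by (simp add: riordan_nth[of "f oo f'"] term_eq sum_distrib_left)
    then show ?thesis
      by (simp add: UT_def)
  qed
qed

lemma riordan_one:
  assumes "\<And>j. j \<ge> 1 \<Longrightarrow> a j \<noteq> 0"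
  shows "riordan a 1 fps_X = \<one>\<^bsub>UT\<^esub>"
  by (intro ext) (use assms in \<open>auto simp: riordan_def UT_def fps_X_power_nth\<close>)

text \<open>The parameters of the inverse solve \<open>f oo f' = fps_X\<close> and
  \<open>d' * (d oo f') = 1\<close>, which makes the product in \<open>riordan_mult\<close> the
  identity.\<close>

lemma riordan_inverse:
  assumes a: "\<And>j. j \<ge> 1 \<Longrightarrow> a j \<noteq> 0"
    and f0: "fps_nth f 0 = 0" and f1: "fps_nth f 1 \<noteq> 0" and d0: "fps_nth d 0 \<noteq> 0"
  shows "riordan a d f \<in> Units UT"
    and "inv\<^bsub>UT\<^esub> (riordan a d f) = riordan a (inverse (d oo fps_inv f)) (fps_inv f)"
proof -
  interpret monoid UT
    by (rule UT_monoid)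
  let ?e = "inverse (d oo fps_inv f)"
  have "?e oo f = inverse ((d oo fps_inv f) oo f)"
    using f0 d0 by (simp add: fps_inverse_compose)
  also have "(d oo fps_inv f) oo f = d"
    using fps_compose_assoc[OF f0, of "fps_inv f" d] fps_inv[OF f0 f1] by simp
  finally have "d * (?e oo f) = 1"
    using inverse_mult_eq_1'[OF d0] by simp
  then have l: "riordan a ?e (fps_inv f) \<otimes>\<^bsub>UT\<^esub> riordan a d f = \<one>\<^bsub>UT\<^esub>"
    by (simp add: riordan_mult[OF a] f0 fps_inv[OF f0 f1] riordan_one[OF a])
  have "?e * (d oo fps_inv f) = 1"
    using d0 by (intro inverse_mult_eq_1) simp
  then have r: "riordan a d f \<otimes>\<^bsub>UT\<^esub> riordan a ?e (fps_inv f) = \<one>\<^bsub>UT\<^esub>"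
    by (simp add: riordan_mult[OF a] f0 fps_inv_right[OF f0 f1] riordan_one[OF a])
  show U: "riordan a d f \<in> Units UT"
    using l r riordan_in_carrier unfolding Units_def by blast
  show "inv\<^bsub>UT\<^esub> (riordan a d f) = riordan a ?e (fps_inv f)"
    using inv_unique[OF l Units_r_inv[OF U]] U riordan_in_carrier by simp
qed

lemma fps_iter_nth_0 [simp]: "fps_nth \<phi> 0 = 0 \<Longrightarrow> fps_nth (fps_iter \<phi> s) 0 = 0"
  by (induction s) simp_all

lemma riordan_pow:
  assumes a: "\<And>j. j \<ge> 1 \<Longrightarrow> a j \<noteq> 0" and f0: "fps_nth f 0 = 0" and d0: "fps_nth d 0 \<noteq> 0"
  shows "riordan a (inverse d) f [^]\<^bsub>UT\<^esub> (s::nat) =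
    riordan a (inverse (\<Prod>i<s. d oo fps_iter f i)) (fps_iter f s)"
proof (induction s)
  case 0
  interpret monoid UT
    by (rule UT_monoid)
  show ?case
    by (simp add: riordan_one[OF a])
next
  case (Suc s)
  interpret monoid UT
    by (rule UT_monoid)
  let ?P = "\<lambda>s. \<Prod>i<s. d oo fps_iter f i"
  have P0: "fps_nth (?P s) 0 \<noteq> 0"
    using d0 by (induction s) simp_all
  \<comment> \<open>Composing with \<open>f\<close> raises every iterate by one, and the new factor
    \<open>d\<close> fills the vacated place \<open>i = 0\<close>.\<close>
  have "d * (?P s oo f) = d * (\<Prod>i<s. d oo fps_iter f (Suc i))"
    using f0 by (simp add: fps_compose_prod_distrib fps_compose_assoc)
  also have "\<dots> = ?P (Suc s)"
    by (subst prod.lessThan_Suc_shift) simp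
  finally have P: "inverse d * (inverse (?P s) oo f) = inverse (?P (Suc s))"
    by (simp only: fps_inverse_compose[OF f0 P0] flip: fps_inverse_mult)
  have "riordan a (inverse d) f [^]\<^bsub>UT\<^esub> Suc s =
      riordan a (inverse (?P s)) (fps_iter f s) \<otimes>\<^bsub>UT\<^esub> riordan a (inverse d) f"
    by (simp only: nat_pow_Suc Suc.IH)
  also have "\<dots> = riordan a (inverse d * (inverse (?P s) oo f)) (fps_iter f s oo f)"
    using f0 by (intro riordan_mult[OF a]) simp_all
  finally show ?case
    by (simp only: P fps_iter.simps)
qed

section \<open>The given matrix and its negative powers\<close>

lemma matA_eq_riordan:
  assumes h0: "fps_nth h 0 \<noteq> 0" and w0: "fps_nth w 0 = 0" and w: "w = fps_X * (h oo w)"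
  shows "matA a \<phi> g h = riordan a (g oo w) (\<phi> oo w)"
proof (intro ext)
  fix k n
  show "matA a \<phi> g h k n = riordan a (g oo w) (\<phi> oo w) k n"
  proof (cases "1 \<le> k \<and> k \<le> n")
    case True
    then have n: "1 \<le> n"
      by simp
    have "fps_nth (fps_nth_deriv (n - 1) (h ^ n * fps_deriv (\<phi> ^ k * g))) 0 =
        fact (n - 1) * (of_nat n * fps_nth ((\<phi> ^ k * g) oo w) n)"
      by (simp only: fps_deriv_maclauren_0 lagrange_inversion[OF h0 w0 w n] of_nat_fact)
    also have "\<dots> = fact n * fps_nth ((g oo w) * (\<phi> oo w) ^ k) n"
      using n by (simp add: fps_compose_mult_distrib[OF w0] fps_compose_power[OF w0] fact_reduce mult_ac)
    finally show ?thesis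
      using True by (simp add: matA_def riordan_def)
  qed (auto simp: matA_def riordan_def)
qed

theorem theorem3:
  fixes a :: "nat \<Rightarrow> complex"
    and \<phi> g h \<psi> \<omega> :: "complex fps"
  assumes "\<And>j. j \<ge> 1 \<Longrightarrow> a j \<noteq> 0"
    and "fps_nth \<phi> 0 = 0"
    and "fps_nth (fps_deriv \<phi>) 0 * fps_nth g 0 * fps_nth h 0 \<noteq> 0"
    and "\<psi> = fps_inv \<phi>"
    and "fps_nth \<omega> 0 = 0" and "\<omega> = fps_X * (h oo \<omega>)"
  shows "\<psi> / (h oo \<psi>) = fps_inv (\<phi> oo \<omega>)
    \<and> matA a \<phi> g h \<in> Units UT
    \<and> (\<forall>(s::nat) k n. 1 \<le> k \<longrightarrow> 1 \<le> n \<longrightarrow>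
        ((inv\<^bsub>UT\<^esub> (matA a \<phi> g h)) [^]\<^bsub>UT\<^esub> s) k n =
          a k / a n * (1 / fact k) *
          fps_nth (fps_nth_deriv n
            (fps_iter (\<psi> / (h oo \<psi>)) s ^ k *
             inverse (\<Prod>i<s. (g oo \<psi>) oo fps_iter (\<psi> / (h oo \<psi>)) i))) 0)"
proof -
  note a = assms(1) and \<phi>0 = assms(2) and \<omega>0 = assms(5) and \<omega> = assms(6)
  have \<phi>1: "fps_nth \<phi> 1 \<noteq> 0" and g0: "fps_nth g 0 \<noteq> 0" and h0: "fps_nth h 0 \<noteq> 0"
    using assms(3) by auto
  have \<psi>\<phi>: "\<psi> oo \<phi> = fps_X"
    using fps_inv[OF \<phi>0 \<phi>1] by (simp add: assms(4))
  define f where "f = \<phi> oo \<omega>"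
  \<comment> \<open>Hence the linear coefficient of \<open>f\<close> is that of
    \<open>\<phi>\<close> times the constant term of \<open>h\<close>, and \<open>f\<close> is
    invertible under composition.\<close>
  have "fps_nth \<omega> 1 = fps_nth h 0"
    by (subst \<omega>) simp
  then have f0: "fps_nth f 0 = 0" and f1: "fps_nth f 1 \<noteq> 0"
    using \<phi>0 \<phi>1 h0 \<omega>0 by (simp_all add: f_def fps_compose_nth_1 del: One_nat_def)
  define \<chi> where "\<chi> = fps_inv f"
  have \<chi>0: "fps_nth \<chi> 0 = 0"
    by (simp add: \<chi>_def)
  have "\<psi> oo f = \<omega>"
    using fps_compose_assoc[OF \<omega>0 \<phi>0, of \<psi>] \<psi>\<phi> \<omega>0 by (simp add: f_def)
  then have \<omega>\<chi>: "\<omega> oo \<chi> = \<psi>"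
    using fps_compose_assoc[OF \<chi>0 f0, of \<psi>] fps_inv_right[OF f0 f1] by (simp add: \<chi>_def)
  \<comment> \<open>Substituting \<open>\<chi>\<close> into the functional equation of
    \<open>\<omega>\<close> yields \<open>\<psi> = \<chi> * (h oo \<psi>)\<close>, which identifies
    the quotient with \<open>fps_inv f\<close>.\<close>
  have "\<psi> = (fps_X oo \<chi>) * ((h oo \<omega>) oo \<chi>)"
    using \<omega>\<chi> \<omega> fps_compose_mult_distrib[OF \<chi>0] by metis
  also have "\<dots> = \<chi> * (h oo \<psi>)"
    using \<omega>\<chi> \<chi>0 \<omega>0 by (simp flip: fps_compose_assoc)
  finally have \<chi>: "\<psi> / (h oo \<psi>) = \<chi>"
    using h0 by (metis fps_compose_nth_0 fps_zero_nth nonzero_mult_div_cancel_right)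
  have matA: "matA a \<phi> g h = riordan a (g oo \<omega>) f"
    unfolding f_def using h0 \<omega>0 \<omega> by (rule matA_eq_riordan)
  have "(g oo \<omega>) oo \<chi> = g oo \<psi>"
    using \<omega>\<chi> \<chi>0 \<omega>0 by (simp flip: fps_compose_assoc)
  then have unit: "matA a \<phi> g h \<in> Units UT"
    and inv: "inv\<^bsub>UT\<^esub> (matA a \<phi> g h) = riordan a (inverse (g oo \<psi>)) \<chi>"
    using riordan_inverse[OF a f0 f1, where d = "g oo \<omega>"] g0 by (simp_all add: matA \<chi>_def)
  \<comment> \<open>The \<open>fact n\<close> in \<open>riordan\<close> turns the coefficient into
    the \<open>n\<close>-th derivative at \<open>0\<close>. For \<open>k > n\<close> both sides
    vanish, as \<open>\<chi>\<close> has no constant term.\<close>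
  have "(inv\<^bsub>UT\<^esub> (matA a \<phi> g h) [^]\<^bsub>UT\<^esub> s) k n = a k / a n * (1 / fact k) *
      fps_nth (fps_nth_deriv n (fps_iter \<chi> s ^ k *
        inverse (\<Prod>i<s. (g oo \<psi>) oo fps_iter \<chi> i))) 0" if "1 \<le> k" for s k n
    using that g0 \<chi>0
    by (simp add: inv riordan_pow[OF a] riordan_nth fps_deriv_maclauren_0 mult_ac)
  then show ?thesis
    using \<chi> unit by (simp add: \<chi>_def f_def)
qed

end
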